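(* Let $q$ be a nonzero real number with $q\neq\pm1$ and let $c$ be a real number. For all real $x,t$ and every nonnegative integer $n$, $$(x+ct)_q^n=\frac{1}{[2]_q^n}\sum_{k=0}^n{n \brack k}_q\,i^k\,q^{\frac{k(k-1)}{2}}\,H_{n-k}(x;q)\,H_k\!\left(-iqct;\tfrac1q\right).$$
   Context: $[n]_q=\frac{q^n-1}{q-1}$, $[n]_q!=[1]_q[2]_q\cdots[n]_q$ (with $[0]_q!=1$), and ${n \brack k}_q=\frac{[n]_q!}{[k]_q!\,[n-k]_q!}$. The $q$-traveling wave binomial is $(x+ct)_q^n=(x+ct)(x+qct)\cdots(x+q^{n-1}ct)$, with $(x+ct)_q^0=1$. Jackson's $q$-exponential is the (formal) power series $e_q(x)=\sum_{n=0}^\infty\frac{x^n}{[n]_q!}$. The $q$-Hermite polynomials $H_n(x;q)$ are defined by the generating function (an identity of formal power series in $s$) $$e_q(-s^2)\,e_q([2]_q\,s\,x)=\sum_{n=0}^\infty H_n(x;q)\frac{s^n}{[n]_q!}.$$ $H_n(x;\frac1q)$ is the polynomial obtained from the same definition with $q$ replaced by $1/q$ everywhere; polynomials are evaluated at complex arguments. Here $i$ is the imaginary unit. *)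

theory Defs
  imports Complex_Main "HOL-Computational_Algebra.Computational_Algebra"
begin

definition q_int :: "'a::field \<Rightarrow> nat \<Rightarrow> 'a" where
  "q_int q n = (q ^ n - 1) / (q - 1)"

definition q_fact :: "'a::field \<Rightarrow> nat \<Rightarrow> 'a" where
  "q_fact q n = (\<Prod>k=1..n. q_int q k)"

definition q_binom :: "'a::field \<Rightarrow> nat \<Rightarrow> nat \<Rightarrow> 'a" where
  "q_binom q n k = q_fact q n / (q_fact q k * q_fact q (n - k))"

definition q_wave_binom :: "'a::field \<Rightarrow> 'a \<Rightarrow> 'a \<Rightarrow> 'a \<Rightarrow> nat \<Rightarrow> 'a" where
  "q_wave_binom q c x t n = (\<Prod>j<n. x + q ^ j * c * t)"

text \<open>
  Jackson's \<open>q\<close>-exponential. Its coefficients are embedded as constant polynomials, so that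
  the indeterminate \<open>x\<close> of the polynomial ring can be used in its argument.
\<close>

definition q_exp :: "'a::field \<Rightarrow> 'a poly fps" where
  "q_exp q = Abs_fps (\<lambda>n. [:1 / q_fact q n:])"

text \<open>
  In the following generating function, a power series over the polynomial ring, \<open>fps_X\<close> is
  the series variable \<open>s\<close> and \<open>[:0, 1:]\<close> is the polynomial variable \<open>x\<close>.
\<close>

definition q_hermite_gf :: "'a::field \<Rightarrow> 'a poly fps" where
  "q_hermite_gf q =
     fps_compose (q_exp q) (- (fps_X ^ 2)) *
     fps_compose (q_exp q) (fps_const [:q_int q 2:] * fps_X * fps_const [:0, 1:])"

definition q_hermite :: "'a::field \<Rightarrow> nat \<Rightarrow> 'a poly" where
  "q_hermite q n = smult (q_fact q n) (fps_nth (q_hermite_gf q) n)"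

lemma q_hermite_generating_function:
  assumes "\<And>n. q_fact q n \<noteq> 0"
  shows "q_hermite_gf q = Abs_fps (\<lambda>n. smult (1 / q_fact q n) (q_hermite q n))"
  using assms by (simp add: fps_eq_iff q_hermite_def)

end

theory Submission
  imports Defs
begin

text \<open>
  The proof multiplies two generating functions. Since the factorials satisfy
  \<open>[k]\<^sub>q! = q\<^bsup>k(k-1)/2\<^esup> [k]\<^sub>p!\<close> for \<open>p = 1/q\<close>, the right-hand side,
  divided by \<open>[n]\<^sub>q!\<close> and freed of the factor \<open>1/[2]\<^sub>q\<^sup>n\<close>, is the \<open>n\<close>-th coefficient of the
  product of the generating function of \<open>H\<^sub>n(x;q)\<close> at \<open>s\<close> and that of \<open>H\<^sub>n(y;p)\<close> at \<open>\<i>s\<close>, where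
  \<open>y = -\<i>qct\<close>. This product is
  \<open>e\<^sub>q(-s\<^sup>2) e\<^sub>q([2]\<^sub>q s x) e\<^sub>p(s\<^sup>2) e\<^sub>p([2]\<^sub>p \<i> s y)\<close>,
  and \<open>[2]\<^sub>p \<i> y = [2]\<^sub>q c t\<close> because \<open>q [2]\<^sub>p = [2]\<^sub>q\<close>.

  Everything then rests on Gauss's \<open>q\<close>-binomial theorem (\<open>jackson_exp_mult\<close>), in the form
  that \<open>e\<^sub>q(a s) e\<^sub>p(b s)\<close> has the coefficients \<open>(a+b)(a+qb)...(a+q\<^bsup>n-1\<^esup>b) / [n]\<^sub>q!\<close>.
  It is used twice: with \<open>a = 1\<close>, \<open>b = -1\<close> all coefficients but the first
  vanish, so the two Gaussian factors \<open>e\<^sub>q(-s\<^sup>2)\<close> and \<open>e\<^sub>p(s\<^sup>2)\<close> cancel; with \<open>a = [2]\<^sub>q x\<close>,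
  \<open>b = [2]\<^sub>q c t\<close> it identifies the remaining factors as the generating function of
  the \<open>q\<close>-traveling wave binomials, taken at \<open>[2]\<^sub>q s\<close>. The \<open>q\<close>-binomial theorem in turn
  follows by induction from the first-order \<open>q\<close>-difference equation of \<open>e\<^sub>q\<close>
  (\<open>jackson_exp_q_shift\<close>), which serves for both bases \<open>q\<close> and \<open>1/q\<close>.

  The argument works over any field containing \<open>\<i>\<close>, as long as \<open>q\<close> is nonzero and no positive
  power of \<open>q\<close> is 1, so that all \<open>q\<close>-factorials are invertible; a real number other than
  \<open>\<plusminus>1\<close> meets the second condition because its absolute value is not 1.
\<close>

section \<open>The \<open>q\<close>-factorial\<close>

lemma q_fact_0 [simp]: "q_fact q 0 = 1"
  by (simp add: q_fact_def)

lemma q_fact_Suc: "q_fact q (Suc n) = q_int q (Suc n) * q_fact q n"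
  by (simp add: q_fact_def mult.commute)

lemma q_int_nonzero:
  fixes q :: "'a::field"
  assumes "\<forall>n>0. q ^ n \<noteq> 1" and "n > 0"
  shows "q_int q n \<noteq> 0"
  using spec[OF assms(1), of n] spec[OF assms(1), of 1] assms(2) by (simp add: q_int_def)

lemma q_fact_nonzero:
  fixes q :: "'a::field"
  assumes "\<forall>n>0. q ^ n \<noteq> 1"
  shows "q_fact q n \<noteq> 0"
  using q_int_nonzero[OF assms] by (simp add: q_fact_def)

lemma q_int_inverse_base:
  fixes q :: "'a::field"
  assumes "q \<noteq> 0"
  shows "q ^ n * q_int (1 / q) (Suc n) = q_int q (Suc n)"
proof (cases "q = 1")
  case False
  then have "q - 1 \<noteq> 0" "1 / q - 1 \<noteq> 0"
    using assms by (auto simp: field_simps)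
  with assms show ?thesis
    by (simp add: q_int_def power_divide divide_simps) (simp add: algebra_simps)
qed (simp add: q_int_def)

lemma q_fact_inverse_base:
  fixes q :: "'a::field"
  assumes "q \<noteq> 0"
  shows "q ^ (k * (k - 1) div 2) * q_fact (1 / q) k = q_fact q k"
proof (induction k)
  case (Suc k)
  have "Suc k * (Suc k - 1) div 2 = k + k * (k - 1) div 2"
    by (cases k) (auto simp: algebra_simps)
  then have "q ^ (Suc k * (Suc k - 1) div 2) * q_fact (1 / q) (Suc k)
      = (q ^ k * q_int (1 / q) (Suc k)) * (q ^ (k * (k - 1) div 2) * q_fact (1 / q) k)"
    by (simp only: power_add q_fact_Suc mult_ac)
  then show ?case
    by (simp only: Suc.IH q_int_inverse_base[OF assms] q_fact_Suc)
qed simp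

section \<open>Jackson's exponential and the \<open>q\<close>-binomial theorem\<close>

text \<open>
  The series \<open>e\<^sub>q(a s)\<close> in \<open>s\<close> over the field itself, in contrast to \<open>q_exp\<close>, which lives over
  the polynomial ring. The factor \<open>a\<close> is a parameter because the \<open>q\<close>-difference equation
  moves it.
\<close>

definition jackson_exp :: "'a::field \<Rightarrow> 'a \<Rightarrow> 'a fps" where
  "jackson_exp q a = Abs_fps (\<lambda>n. a ^ n / q_fact q n)"

lemma jackson_exp_nth [simp]: "fps_nth (jackson_exp q a) n = a ^ n / q_fact q n"
  by (simp add: jackson_exp_def)

lemma jackson_exp_scale:
  "fps_compose (jackson_exp q a) (fps_const b * fps_X) = jackson_exp q (a * b)"
  by (rule fps_ext) (simp add: fps_compose_linear power_mult_distrib)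

text \<open>
  This says that \<open>e\<^sub>q(a s)\<close> is an eigenfunction of the \<open>q\<close>-derivative, with the division by
  \<open>(q - 1) s\<close> cleared.
\<close>

lemma jackson_exp_q_shift:
  fixes q :: "'a::field"
  assumes "\<forall>n>0. q ^ n \<noteq> 1"
  shows "jackson_exp q (q * a) = (1 + fps_const ((q - 1) * a) * fps_X) * jackson_exp q a"
proof (rule fps_ext)
  fix n
  show "fps_nth (jackson_exp q (q * a)) n
      = fps_nth ((1 + fps_const ((q - 1) * a) * fps_X) * jackson_exp q a) n"
  proof (cases n)
    case (Suc m)
    have "q_int q (Suc m) \<noteq> 0" "q_fact q m \<noteq> 0"
      using q_int_nonzero[OF assms] q_fact_nonzero[OF assms] by auto
    moreover have "q ^ Suc m = 1 + (q - 1) * q_int q (Suc m)"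
      using spec[OF assms, of 1] by (simp add: q_int_def)
    ultimately have "(q * a) ^ Suc m / q_fact q (Suc m)
        = a ^ Suc m / q_fact q (Suc m) + (q - 1) * a * (a ^ m / q_fact q m)"
      by (simp only: power_mult_distrib q_fact_Suc) (simp add: field_simps)
    then show ?thesis
      unfolding Suc by (simp add: distrib_right mult.assoc)
  qed (simp add: distrib_right mult.assoc)
qed

text \<open>
  Write \<open>F(a,b) = e\<^sub>q(a s) e\<^sub>p(b s)\<close> with \<open>p = 1/q\<close>. Shifting \<open>a\<close> in the first
  factor and, with base \<open>p\<close>, \<open>q b\<close> in the second expresses both \<open>F(qa,qb)\<close> and
  \<open>F(a,b)\<close> through \<open>F(a,qb)\<close>. As \<open>F(qa,qb)\<close> is \<open>F(a,b)\<close> at \<open>q s\<close>, comparing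
  coefficients gives \<open>[n+1] F(a,b)\<^bsub>n+1\<^esub> = (a+b) F(a,qb)\<^sub>n\<close>, which is also the recursion
  obtained by splitting off the first factor \<open>a + b\<close> of the product.
\<close>

lemma jackson_exp_mult_nth_Suc:
  fixes q :: "'a::field"
  assumes "q \<noteq> 0" and roots: "\<forall>n>0. q ^ n \<noteq> 1"
  shows "q_int q (Suc n) * fps_nth (jackson_exp q a * jackson_exp (1 / q) b) (Suc n)
    = (a + b) * fps_nth (jackson_exp q a * jackson_exp (1 / q) (q * b)) n"
proof -
  let ?A = "jackson_exp q a" and ?B = "jackson_exp (1 / q)"
  have roots': "\<forall>m>0. (1 / q) ^ m \<noteq> 1"
    using roots by (simp add: power_one_over)
  have b: "?B b = (1 + fps_const (- ((q - 1) * b)) * fps_X) * ?B (q * b)"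
    using jackson_exp_q_shift[OF roots', of "q * b"] assms(1)
    by (simp add: algebra_simps)
  have "jackson_exp q (q * a) * ?B (q * b) - ?A * ?B b
      = (fps_const ((q - 1) * a) - fps_const (- ((q - 1) * b))) * fps_X * (?A * ?B (q * b))"
    unfolding jackson_exp_q_shift[OF roots] b by (simp only: algebra_simps)
  also have "\<dots> = fps_const ((q - 1) * (a + b)) * (fps_X * (?A * ?B (q * b)))"
    by (simp add: algebra_simps del: fps_const_mult)
  finally have "fps_nth (jackson_exp q (q * a) * ?B (q * b)) (Suc n) - fps_nth (?A * ?B b) (Suc n)
      = (q - 1) * (a + b) * fps_nth (?A * ?B (q * b)) n"
    by (simp flip: fps_sub_nth)
  moreover have "jackson_exp q (q * a) * ?B (q * b)
      = fps_compose (?A * ?B b) (fps_const q * fps_X)"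
    by (subst fps_compose_mult_distrib) (simp_all add: jackson_exp_scale mult.commute[of q])
  then have "fps_nth (jackson_exp q (q * a) * ?B (q * b)) (Suc n)
      = q ^ Suc n * fps_nth (?A * ?B b) (Suc n)"
    by (simp only: fps_compose_linear fps_nth_Abs_fps)
  ultimately have "(q ^ Suc n - 1) * fps_nth (?A * ?B b) (Suc n)
      = (q - 1) * ((a + b) * fps_nth (?A * ?B (q * b)) n)"
    by (simp only: left_diff_distrib mult_1 mult.assoc)
  then show ?thesis
    using spec[OF roots, of 1] by (simp add: q_int_def divide_eq_eq mult.commute)
qed

lemma jackson_exp_mult:
  fixes q :: "'a::field"
  assumes "q \<noteq> 0" and "\<forall>n>0. q ^ n \<noteq> 1"
  shows "fps_nth (jackson_exp q a * jackson_exp (1 / q) b) n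
    = (\<Prod>j<n. a + q ^ j * b) / q_fact q n"
proof (induction n arbitrary: b)
  case (Suc n)
  have "q_int q (Suc n) * fps_nth (jackson_exp q a * jackson_exp (1 / q) b) (Suc n)
      = (a + b) * ((\<Prod>j<n. a + q ^ j * (q * b)) / q_fact q n)"
    by (simp only: jackson_exp_mult_nth_Suc[OF assms] Suc.IH)
  also have "\<dots> = (\<Prod>j<Suc n. a + q ^ j * b) / q_fact q n"
    by (subst prod.lessThan_Suc_shift) (simp add: mult_ac)
  finally show ?case
    using q_int_nonzero[OF assms(2), of "Suc n"] q_fact_nonzero[OF assms(2), of n]
    by (simp add: q_fact_Suc field_simps del: prod.lessThan_Suc)
qed simp

lemma jackson_exp_mult_inverse:
  fixes q :: "'a::field"
  assumes "q \<noteq> 0" and "\<forall>n>0. q ^ n \<noteq> 1"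
  shows "jackson_exp q 1 * jackson_exp (1 / q) (- 1) = 1"
proof (rule fps_ext)
  fix n
  have "(\<Prod>j<n. 1 + q ^ j * (- 1)) = (if n = 0 then 1 else 0)"
    by (cases n) (auto simp: prod.lessThan_Suc_shift simp del: prod.lessThan_Suc)
  then show "fps_nth (jackson_exp q 1 * jackson_exp (1 / q) (- 1)) n = fps_nth 1 n"
    by (simp only: jackson_exp_mult[OF assms]) simp
qed

section \<open>The Hermite generating function at a point\<close>

text \<open>
  Evaluation of the coefficients at a point is a ring homomorphism from power series over the
  polynomials to power series over the field, and it commutes with substitution. Through it
  the defining generating function, whose \<open>x\<close> is an indeterminate, can be used at a number.
\<close>

definition eval_coeffs :: "'a::field \<Rightarrow> 'a poly fps \<Rightarrow> 'a fps" where
  "eval_coeffs x f = Abs_fps (\<lambda>n. poly (fps_nth f n) x)"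

lemma eval_coeffs_nth [simp]: "fps_nth (eval_coeffs x f) n = poly (fps_nth f n) x"
  by (simp add: eval_coeffs_def)

lemma eval_coeffs_mult: "eval_coeffs x (f * g) = eval_coeffs x f * eval_coeffs x g"
  by (rule fps_ext) (simp add: fps_mult_nth poly_sum)

lemma eval_coeffs_1 [simp]: "eval_coeffs x 1 = 1"
  by (rule fps_ext) simp

lemma eval_coeffs_power: "eval_coeffs x (f ^ n) = eval_coeffs x f ^ n"
  by (induction n) (simp_all add: eval_coeffs_mult)

lemma eval_coeffs_compose:
  "eval_coeffs x (fps_compose f g) = fps_compose (eval_coeffs x f) (eval_coeffs x g)"
  by (rule fps_ext) (simp add: fps_compose_nth poly_sum flip: eval_coeffs_power)

lemma eval_coeffs_uminus: "eval_coeffs x (- f) = - eval_coeffs x f"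
  by (rule fps_ext) simp

lemma eval_coeffs_X [simp]: "eval_coeffs x fps_X = fps_X"
  by (rule fps_ext) (simp add: fps_X_def)

lemma eval_coeffs_const [simp]: "eval_coeffs x (fps_const p) = fps_const (poly p x)"
  by (rule fps_ext) simp

lemma eval_coeffs_q_exp [simp]: "eval_coeffs x (q_exp q) = jackson_exp q 1"
  by (rule fps_ext) (simp add: q_exp_def)

lemma eval_coeffs_q_hermite_gf:
  fixes x :: "'a::field"
  shows "eval_coeffs x (q_hermite_gf q)
    = fps_compose (jackson_exp q 1) (- (fps_X ^ 2)) * jackson_exp q (q_int q 2 * x)"
proof -
  have "fps_const (q_int q 2) * fps_X * fps_const x = fps_const (q_int q 2 * x) * fps_X"
    by (simp add: mult_ac flip: fps_const_mult)
  then have "fps_compose (jackson_exp q 1) (fps_const (q_int q 2) * fps_X * fps_const x)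
      = jackson_exp q (q_int q 2 * x)"
    by (simp only: jackson_exp_scale mult_1)
  then show ?thesis
    unfolding q_hermite_gf_def
    by (simp add: eval_coeffs_mult eval_coeffs_compose eval_coeffs_uminus eval_coeffs_power)
qed

lemma poly_q_hermite:
  "poly (q_hermite q n) x = q_fact q n * fps_nth (eval_coeffs x (q_hermite_gf q)) n"
  by (simp add: q_hermite_def)

text \<open>
  The substitution \<open>s \<mapsto> \<i> s\<close> turns the Gaussian factor \<open>e\<^sub>q(-s\<^sup>2)\<close> into \<open>e\<^sub>q(s\<^sup>2)\<close>, written
  here as \<open>e\<^sub>q(-u)\<close> at \<open>u = -s\<^sup>2\<close> so that it faces its inverse with the same substitution.
\<close>

lemma eval_coeffs_q_hermite_gf_rotate:
  fixes i y :: "'a::field"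
  assumes "i ^ 2 = - 1"
  shows "fps_compose (eval_coeffs y (q_hermite_gf q)) (fps_const i * fps_X)
    = fps_compose (jackson_exp q (- 1)) (- (fps_X ^ 2)) * jackson_exp q (q_int q 2 * y * i)"
proof -
  let ?iX = "fps_const i * fps_X :: 'a fps" and ?mX = "fps_const (- 1) * fps_X :: 'a fps"
  have "fps_compose (- (fps_X ^ 2)) ?iX = - (?iX ^ 2)"
    by (simp add: fps_compose_uminus flip: fps_compose_power)
  also have "?iX ^ 2 = - (fps_X ^ 2)"
    using assms by (simp add: power_mult_distrib fps_const_power)
  also have "- (- (fps_X ^ 2)) = fps_compose ?mX (- (fps_X ^ 2))"
    by (simp add: fps_compose_mult_distrib)
  finally have subst: "fps_compose (- (fps_X ^ 2)) ?iX = fps_compose ?mX (- (fps_X ^ 2))" .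
  have "fps_compose (fps_compose (jackson_exp q 1) (- (fps_X ^ 2))) ?iX
      = fps_compose (jackson_exp q 1) (fps_compose (- (fps_X ^ 2)) ?iX)"
    by (rule fps_compose_assoc[symmetric]) simp_all
  also have "\<dots> = fps_compose (fps_compose (jackson_exp q 1) ?mX) (- (fps_X ^ 2))"
    unfolding subst by (rule fps_compose_assoc) simp_all
  also have "fps_compose (jackson_exp q 1) ?mX = jackson_exp q (- 1)"
    by (simp only: jackson_exp_scale mult_1)
  finally show ?thesis
    unfolding eval_coeffs_q_hermite_gf
    by (simp add: fps_compose_mult_distrib jackson_exp_scale)
qed

section \<open>The expansion of the traveling wave binomial\<close>

lemma hermite_gf_product:
  fixes q x y i :: "'a::field"
  assumes "q \<noteq> 0" and "\<forall>n>0. q ^ n \<noteq> 1" and "i ^ 2 = - 1"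
  shows "eval_coeffs x (q_hermite_gf q) *
      fps_compose (eval_coeffs y (q_hermite_gf (1 / q))) (fps_const i * fps_X)
    = jackson_exp q (q_int q 2 * x) * jackson_exp (1 / q) (q_int (1 / q) 2 * y * i)"
proof -
  let ?e = "fps_compose (jackson_exp q 1) (- (fps_X ^ 2))"
    and ?e' = "fps_compose (jackson_exp (1 / q) (- 1)) (- (fps_X ^ 2))"
  have "?e * ?e' = fps_compose (jackson_exp q 1 * jackson_exp (1 / q) (- 1)) (- (fps_X ^ 2))"
    by (rule fps_compose_mult_distrib[symmetric]) simp
  also have "\<dots> = 1"
    by (simp add: jackson_exp_mult_inverse[OF assms(1,2)])
  finally have cancel: "?e * ?e' = 1" .
  have "(?e * f) * (?e' * g) = (?e * ?e') * (f * g)" for f g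
    by (simp only: mult_ac)
  then show ?thesis
    unfolding eval_coeffs_q_hermite_gf_rotate[OF assms(3)] cancel
    unfolding eval_coeffs_q_hermite_gf
    by (simp only: mult_1)
qed

theorem q_wave_binom_hermite_expansion:
  fixes q c x t i :: "'a::field"
  assumes q: "q \<noteq> 0" and roots: "\<forall>n>0. q ^ n \<noteq> 1" and i: "i ^ 2 = - 1"
  shows "q_int q 2 ^ n * q_wave_binom q c x t n =
    (\<Sum>k=0..n. q_binom q n k * i ^ k * q ^ (k * (k - 1) div 2) *
       poly (q_hermite q (n - k)) x * poly (q_hermite (1 / q) k) (- i * (q * c * t)))"
proof -
  define y where "y = - i * (q * c * t)"
  let ?f = "eval_coeffs x (q_hermite_gf q)"
  let ?g = "fps_compose (eval_coeffs y (q_hermite_gf (1 / q))) (fps_const i * fps_X)"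
  have summand: "q_binom q n k * i ^ k * q ^ (k * (k - 1) div 2) *
      poly (q_hermite q (n - k)) x * poly (q_hermite (1 / q) k) y
    = q_fact q n * (fps_nth ?g k * fps_nth ?f (n - k))" for k
  proof -
    have "q_fact q k \<noteq> 0" "q_fact q (n - k) \<noteq> 0"
      using q_fact_nonzero[OF roots] by auto
    then have fact: "q_binom q n k * (q ^ (k * (k - 1) div 2) * q_fact (1 / q) k)
        * q_fact q (n - k) = q_fact q n"
      by (simp only: q_fact_inverse_base[OF q] q_binom_def) (simp add: field_simps)
    have g: "fps_nth ?g k = i ^ k * fps_nth (eval_coeffs y (q_hermite_gf (1 / q))) k"
      by (simp only: fps_compose_linear fps_nth_Abs_fps)
    show ?thesis
      unfolding poly_q_hermite g fact[symmetric] by (simp only: mult_ac)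
  qed
  have "q_int q 2 = q * q_int (1 / q) 2"
    using q_int_inverse_base[OF q, of 1] by (simp add: numeral_2_eq_2)
  then have "q_int (1 / q) 2 * y * i = - (i ^ 2) * (q_int q 2 * (c * t))"
    by (simp add: y_def power2_eq_square mult_ac)
  then have arg: "q_int (1 / q) 2 * y * i = q_int q 2 * (c * t)"
    by (simp add: i)
  have "(\<Sum>k=0..n. q_fact q n * (fps_nth ?g k * fps_nth ?f (n - k)))
      = q_fact q n * fps_nth (?f * ?g) n"
    by (simp only: mult.commute[of ?f] fps_mult_nth sum_distrib_left)
  also have "\<dots> = (\<Prod>j<n. q_int q 2 * x + q ^ j * (q_int q 2 * (c * t)))"
    unfolding hermite_gf_product[OF q roots i] arg jackson_exp_mult[OF q roots]
    using q_fact_nonzero[OF roots] by simp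
  also have "\<dots> = (\<Prod>j<n. q_int q 2 * (x + q ^ j * c * t))"
    by (simp add: algebra_simps)
  also have "\<dots> = q_int q 2 ^ n * q_wave_binom q c x t n"
    by (simp add: prod.distrib q_wave_binom_def)
  finally show ?thesis
    by (simp only: y_def[symmetric] summand)
qed

lemma of_real_q_int: "of_real (q_int q n) = (q_int (of_real q) n :: 'a::real_field)"
  by (simp add: q_int_def)

lemma of_real_q_fact: "of_real (q_fact q n) = (q_fact (of_real q) n :: 'a::real_field)"
  by (simp add: q_fact_def of_real_q_int)

lemma of_real_q_binom: "of_real (q_binom q n k) = (q_binom (of_real q) n k :: 'a::real_field)"
  by (simp add: q_binom_def of_real_q_fact)

lemma of_real_q_wave_binom:
  "of_real (q_wave_binom q c x t n)
    = (q_wave_binom (of_real q) (of_real c) (of_real x) (of_real t) n :: 'a::real_field)"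
  by (simp add: q_wave_binom_def)

theorem mainTheorem5:
  fixes q c x t :: real and n :: nat
  assumes "q \<noteq> 0" and "q \<noteq> 1" and "q \<noteq> -1"
  shows "complex_of_real (q_wave_binom q c x t n) =
    1 / complex_of_real (q_int q 2) ^ n *
    (\<Sum>k=0..n. complex_of_real (q_binom q n k) * \<i> ^ k *
       complex_of_real (q ^ (k * (k - 1) div 2)) *
       poly (q_hermite (complex_of_real q) (n - k)) (complex_of_real x) *
       poly (q_hermite (complex_of_real (1 / q)) k) (- \<i> * complex_of_real (q * c * t)))"
proof -
  let ?q = "complex_of_real q"
  have roots: "\<forall>m>0. ?q ^ m \<noteq> 1"
  proof (intro allI impI notI)
    fix m :: nat
    assume "m > 0" and "?q ^ m = 1"
    then have "\<bar>q\<bar> = 1"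
      using power_eq_1_iff[of ?q m] by simp
    with assms show False
      by auto
  qed
  have q: "?q \<noteq> 0"
    using assms by simp
  have i: "\<i> ^ 2 = - 1"
    by simp
  let ?W = "q_wave_binom ?q (of_real c) (of_real x) (of_real t) n"
  have "q_int ?q 2 \<noteq> 0"
    using q_int_nonzero[OF roots] by simp
  then have "?W = 1 / q_int ?q 2 ^ n * (q_int ?q 2 ^ n * ?W)"
    by simp
  then show ?thesis
    unfolding q_wave_binom_hermite_expansion[OF q roots i]
    by (simp only: of_real_q_int of_real_q_binom of_real_q_wave_binom of_real_power
        of_real_divide of_real_mult of_real_1)
qed

end
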